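(* Let $\equiv$ be a lattice congruence of the weak order on $S_n$ and let $F_A=A_1|\cdots|A_{n-d}$ and $F_B=B_1|\cdots|B_{n-d}$ be two equivalent stable ordered partitions of $[n]$. Then there exists a sequence of adjacent transpositions of blocks that transforms $F_A$ into $F_B$ such that each intermediate ordered partition is stable and equivalent to $F_A$ and $F_B$. In particular, $F_B$ is a reordering of the blocks of $F_A$. Moreover, the sequence can be chosen such that each pair of blocks is swapped at most once.
   Context: $S_n$ carries the weak order (inclusion of inversion sets), a lattice; $\equiv$ is a lattice congruence (equivalence preserving joins and meets). An ordered partition $A_1|\cdots|A_k$ of $[n]$ is identified with the set of permutations (words) listing the elements of $A_1$ first in any order, then those of $A_2$, etc. Two ordered partitions $F,F'$ are equivalent, $F\equiv F'$, if every permutation in $F$ is $\equiv$-equivalent to one in $F'$ and vice versa. $F$ is stable if every ordered partition equivalent to $F$ has at most as many blocks as $F$. An adjacent transposition of blocks replaces $C_1|\cdots|C_i|C_{i+1}|\cdots|C_k$ by $C_1|\cdots|C_{i+1}|C_i|\cdots|C_k$. *)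

theory Defs
  imports "HOL-Algebra.Lattice" "HOL-Combinatorics.Multiset_Permutations"
begin

text \<open>A permutation of \<open>{1..n}\<close> is represented by its one-line notation, a list in
  \<^term>\<open>permutations_of_set {1..n}\<close>. Inversions are pairs of \<^emph>\<open>values\<close>, so that the words
  of an ordered partition form an interval of the weak order.\<close>

definition inversion_set :: "nat list \<Rightarrow> (nat \<times> nat) set" where
  "inversion_set w = {(w ! i, w ! j) | i j. i < j \<and> j < length w \<and> w ! i > w ! j}"

definition weak_order :: "nat \<Rightarrow> nat list gorder" where
  "weak_order n =
    \<lparr>carrier = permutations_of_set {1..n}, eq = (=),
     le = (\<lambda>v w. inversion_set v \<subseteq> inversion_set w)\<rparr>"

definition lattice_congruence :: "'a gorder \<Rightarrow> ('a \<times> 'a) set \<Rightarrow> bool" where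
  "lattice_congruence L r \<longleftrightarrow>
    equiv (carrier L) r \<and>
    (\<forall>x x' y y'. (x, x') \<in> r \<longrightarrow> (y, y') \<in> r \<longrightarrow>
      (x \<squnion>\<^bsub>L\<^esub> y, x' \<squnion>\<^bsub>L\<^esub> y') \<in> r \<and>
      (x \<sqinter>\<^bsub>L\<^esub> y, x' \<sqinter>\<^bsub>L\<^esub> y') \<in> r)"

definition ordered_partition :: "nat \<Rightarrow> nat set list \<Rightarrow> bool" where
  "ordered_partition n F \<longleftrightarrow> distinct F \<and> partition_on {1..n} (set F)"

definition words :: "nat set list \<Rightarrow> nat list set" where
  "words F = concat ` listset (map permutations_of_set F)"

definition op_equiv :: "(nat list \<times> nat list) set \<Rightarrow> nat set list \<Rightarrow> nat set list \<Rightarrow> bool" where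
  "op_equiv r F F' \<longleftrightarrow>
    (\<forall>v\<in>words F. \<exists>w\<in>words F'. (v, w) \<in> r) \<and>
    (\<forall>w\<in>words F'. \<exists>v\<in>words F. (w, v) \<in> r)"

definition stable_op :: "nat \<Rightarrow> (nat list \<times> nat list) set \<Rightarrow> nat set list \<Rightarrow> bool" where
  "stable_op n r F \<longleftrightarrow>
    (\<forall>F'. ordered_partition n F' \<longrightarrow> op_equiv r F F' \<longrightarrow> length F' \<le> length F)"

text \<open>\<open>block_swap P F F'\<close>: \<open>F'\<close> arises from \<open>F\<close> by transposing two adjacent blocks,
  and \<open>P\<close> is the unordered pair of these blocks.\<close>

definition block_swap :: "nat set set \<Rightarrow> nat set list \<Rightarrow> nat set list \<Rightarrow> bool" where
  "block_swap P F F' \<longleftrightarrow>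
    (\<exists>us C D vs. F = us @ [C, D] @ vs \<and> F' = us @ [D, C] @ vs \<and> P = {C, D})"

definition swap_sequence ::
  "nat \<Rightarrow> (nat list \<times> nat list) set \<Rightarrow> nat set list \<Rightarrow> nat set list \<Rightarrow> nat set list list \<Rightarrow> bool"
where
  "swap_sequence n r F\<^sub>A F\<^sub>B Fs \<longleftrightarrow>
    Fs \<noteq> [] \<and> hd Fs = F\<^sub>A \<and> last Fs = F\<^sub>B \<and>
    (\<forall>i. Suc i < length Fs \<longrightarrow> (\<exists>P. block_swap P (Fs ! i) (Fs ! Suc i))) \<and>
    (\<forall>F\<in>set Fs. ordered_partition n F \<and> stable_op n r F \<and>
      op_equiv r F F\<^sub>A \<and> op_equiv r F F\<^sub>B)"

definition swaps_at_most_once :: "nat set list list \<Rightarrow> bool" where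
  "swaps_at_most_once Fs \<longleftrightarrow>
    (\<forall>P i j. Suc i < length Fs \<longrightarrow> Suc j < length Fs \<longrightarrow>
      block_swap P (Fs ! i) (Fs ! Suc i) \<longrightarrow> block_swap P (Fs ! j) (Fs ! Suc j) \<longrightarrow> i = j)"

end

theory Submission
  imports Defs
begin

text \<open>The words of an ordered partition form an interval of the weak order, so two ordered partitions
  are equivalent if and only if the least words and the greatest words are. Since congruence classes are
  convex, an ordered partition whose block order lies between those of two equivalent ones \<open>F\<close> and
  \<open>G\<close>, in the sense that it contains their intersection and is contained in their union, is
  equivalent to both. This applies to the lexicographic common refinement of \<open>F\<close> and \<open>G\<close>, which by
  stability must coincide with \<open>F\<close>, so that stable equivalent ordered partitions have the same blocks.
  It applies again to the result of swapping adjacent blocks of \<open>F\<close> that appear in the opposite order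
  in \<open>G\<close>, so bubble sort stays within the equivalence class and swaps only inverted pairs.\<close>

section \<open>Words as linear orders\<close>

text \<open>Polymorphic because it serves twice: for the letters of a permutation and for the blocks
  of an ordered partition. On a distinct list it is a strict linear order of the entries.\<close>

definition precedes :: "'a list \<Rightarrow> 'a \<Rightarrow> 'a \<Rightarrow> bool" where
  "precedes w x y \<longleftrightarrow> (\<exists>i j. i < j \<and> j < length w \<and> w ! i = x \<and> w ! j = y)"

lemma precedes_in_set:
  assumes "precedes w x y"
  shows "x \<in> set w" "y \<in> set w"
  using assms unfolding precedes_def by (auto intro: nth_mem)

lemma precedes_total:
  assumes "x \<in> set w" "y \<in> set w" "x \<noteq> y"
  shows "precedes w x y \<or> precedes w y x"
proof -
  from assms obtain i j where "i < length w" "w ! i = x" "j < length w" "w ! j = y"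
    by (metis in_set_conv_nth)
  then show ?thesis using assms(3) unfolding precedes_def by (metis nat_neq_iff)
qed

lemma precedes_trans:
  assumes "distinct w" "precedes w x y" "precedes w y z"
  shows "precedes w x z"
proof -
  from assms(2,3) obtain i j k l where "i < j" "j < length w" "w ! i = x" "w ! j = y"
    "k < l" "l < length w" "w ! k = y" "w ! l = z"
    unfolding precedes_def by blast
  moreover from this have "j = k"
    using assms(1) by (metis nth_eq_iff_index_eq order.strict_trans)
  ultimately show ?thesis unfolding precedes_def by (metis order.strict_trans)
qed

lemma precedes_irrefl:
  assumes "distinct w"
  shows "\<not> precedes w x x"
proof
  assume "precedes w x x"
  then obtain i j where "i < j" "j < length w" "w ! i = w ! j" unfolding precedes_def by metis
  then show False using assms by (metis nth_eq_iff_index_eq order.strict_trans less_irrefl)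
qed

lemma precedes_asym:
  assumes "distinct w" "precedes w x y"
  shows "\<not> precedes w y x"
  using precedes_trans[OF assms] precedes_irrefl[OF assms(1)] by blast

lemma precedes_Cons: "precedes (a # w) x y \<longleftrightarrow> (x = a \<and> y \<in> set w) \<or> precedes w x y"
proof
  assume "precedes (a # w) x y"
  then obtain i j where ij: "i < j" "j < Suc (length w)" "(a # w) ! i = x" "(a # w) ! j = y"
    unfolding precedes_def by auto
  then obtain j' where j': "j = Suc j'" by (cases j) auto
  show "(x = a \<and> y \<in> set w) \<or> precedes w x y"
  proof (cases i)
    case 0
    then show ?thesis using ij j' by auto
  next
    case (Suc i')
    then show ?thesis using ij j' unfolding precedes_def by auto
  qed
next
  assume "(x = a \<and> y \<in> set w) \<or> precedes w x y"
  then show "precedes (a # w) x y"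
  proof
    assume "x = a \<and> y \<in> set w"
    then obtain j where "j < length w" "w ! j = y" "x = a" by (metis in_set_conv_nth)
    then show ?thesis unfolding precedes_def
      by (intro exI[of _ 0] exI[of _ "Suc j"]) auto
  next
    assume "precedes w x y"
    then obtain i j where "i < j" "j < length w" "w ! i = x" "w ! j = y"
      unfolding precedes_def by blast
    then show ?thesis unfolding precedes_def
      by (intro exI[of _ "Suc i"] exI[of _ "Suc j"]) auto
  qed
qed

lemma not_precedes_Nil: "\<not> precedes [] x y"
  by (simp add: precedes_def)

lemma precedes_append:
  "precedes (u @ v) x y \<longleftrightarrow> precedes u x y \<or> precedes v x y \<or> (x \<in> set u \<and> y \<in> set v)"
  by (induction u) (auto simp: precedes_Cons not_precedes_Nil)

lemma sorted_wrt_iff_precedes: "sorted_wrt R w \<longleftrightarrow> (\<forall>x y. precedes w x y \<longrightarrow> R x y)"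
  by (auto simp: sorted_wrt_iff_nth_less precedes_def)

text \<open>Induction on first entries: if these were \<open>a\<close> in \<open>u\<close> and
  \<open>b\<close> in \<open>v\<close> with \<open>a \<noteq> b\<close>, then \<open>b\<close> would
  occur later in \<open>u\<close>, so \<open>a\<close> would have to precede the head
  \<open>b\<close> of \<open>v\<close>.\<close>

lemma precedes_unique:
  assumes "distinct u" "distinct v" "set u = set v" "\<And>x y. precedes u x y \<Longrightarrow> precedes v x y"
  shows "u = v"
  using assms
proof (induction u arbitrary: v)
  case Nil
  then show ?case by simp
next
  case (Cons a u)
  then obtain b v' where v: "v = b # v'" by (cases v) auto
  have "a = b"
  proof (rule ccontr)
    assume "a \<noteq> b"
    moreover have "b \<in> insert a (set u)" using Cons.prems(3) v by simp
    ultimately have "b \<in> set u" by blast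
    then have "precedes v a b" using Cons.prems by (simp add: precedes_Cons)
    moreover have "precedes v b a" using v \<open>a \<noteq> b\<close> Cons.prems(3) by (auto simp: precedes_Cons)
    ultimately show False using Cons.prems(2) precedes_asym by metis
  qed
  moreover have "u = v'"
  proof (rule Cons.IH)
    show "distinct u" "distinct v'" using Cons.prems v by auto
    show "set u = set v'" using Cons.prems v \<open>a = b\<close> by (simp add: insert_ident)
    fix x y assume xy: "precedes u x y"
    then have "precedes v x y" "x \<noteq> a"
      using Cons.prems precedes_in_set[OF xy] by (auto simp: precedes_Cons)
    then show "precedes v' x y" using v \<open>a = b\<close> by (simp add: precedes_Cons)
  qed
  ultimately show ?case using v by simp
qed

text \<open>Sorting \<open>S\<close> by the number of \<open>R\<close>-predecessors works because
  this number is strictly monotone along \<open>R\<close>.\<close>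

lemma linear_order_word:
  assumes "finite S"
    and trans: "\<And>x y z. x \<in> S \<Longrightarrow> y \<in> S \<Longrightarrow> z \<in> S \<Longrightarrow> R x y \<Longrightarrow> R y z \<Longrightarrow> R x z"
    and irrefl: "\<And>x. x \<in> S \<Longrightarrow> \<not> R x x"
    and total: "\<And>x y. x \<in> S \<Longrightarrow> y \<in> S \<Longrightarrow> x \<noteq> y \<Longrightarrow> R x y \<or> R y x"
  obtains w where "set w = S" "distinct w" "\<And>x y. precedes w x y \<longleftrightarrow> x \<in> S \<and> y \<in> S \<and> R x y"
proof -
  define k where "k x = card {y \<in> S. R y x}" for x
  have mono: "k x < k y" if "x \<in> S" "y \<in> S" "R x y" for x y
  proof -
    have "{z \<in> S. R z x} \<subseteq> {z \<in> S. R z y}" using trans[OF _ that(1,2) _ that(3)] by blast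
    moreover have "x \<in> {z \<in> S. R z y}" "x \<notin> {z \<in> S. R z x}" using that irrefl by auto
    ultimately have "{z \<in> S. R z x} \<subset> {z \<in> S. R z y}" by blast
    then show ?thesis unfolding k_def using assms(1) by (intro psubset_card_mono) auto
  qed
  have "\<exists>xs. set xs = S \<and> distinct xs" using assms(1) finite_distinct_list by auto
  then obtain xs where xs: "set xs = S" "distinct xs" by blast
  define w where "w = sort_key k xs"
  have w: "set w = S" "distinct w" using xs by (auto simp: w_def)
  \<comment> \<open>Sorting yields only weak inequalities of \<open>k\<close>; totality of
    \<open>R\<close> and strict monotonicity of \<open>k\<close> then exclude the wrong
    direction.\<close>
  have "sorted_wrt (\<lambda>x y. k x \<le> k y) w"
    using sorted_sort_key[of k xs] by (simp add: w_def sorted_wrt_map)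
  then have le: "k x \<le> k y" if "precedes w x y" for x y
    using that by (simp add: sorted_wrt_iff_precedes)
  have "precedes w x y \<longleftrightarrow> x \<in> S \<and> y \<in> S \<and> R x y" for x y
  proof
    assume p: "precedes w x y"
    then have xy: "x \<in> S" "y \<in> S" using precedes_in_set w by metis+
    moreover have "x \<noteq> y" using p w(2) precedes_irrefl by metis
    ultimately show "x \<in> S \<and> y \<in> S \<and> R x y"
      using total mono[of y x] le[OF p] by fastforce
  next
    assume a: "x \<in> S \<and> y \<in> S \<and> R x y"
    then have "x \<noteq> y" using irrefl by auto
    then show "precedes w x y"
      using precedes_total[of x w y] a w(1) mono[of x y] le[of y x] by fastforce
  qed
  then show thesis using that w by blast
qed

section \<open>Inversion sets and the weak order\<close>

lemma inversion_set_iff: "(x, y) \<in> inversion_set w \<longleftrightarrow> precedes w x y \<and> y < x"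
  by (auto simp: inversion_set_def precedes_def)

text \<open>In terms of root systems these are the closed and coclosed sets of positive roots of
  type A. The last clause is transitivity of the complement within the decreasing pairs, which makes
  the notion invariant under complementation.\<close>

definition biclosed :: "nat \<Rightarrow> (nat \<times> nat) set \<Rightarrow> bool" where
  "biclosed n I \<longleftrightarrow> I \<subseteq> {(x, y). x \<in> {1..n} \<and> y \<in> {1..n} \<and> y < x} \<and> trans I \<and>
    (\<forall>x y z. (x, z) \<in> I \<longrightarrow> z < y \<longrightarrow> y < x \<longrightarrow> (x, y) \<in> I \<or> (y, z) \<in> I)"

text \<open>Recovers the whole linear order from the inversion set: an increasing pair stands in
  order exactly when its reversal is not an inversion. Hence words with equal inversion sets
  coincide.\<close>

lemma precedes_iff_inversion_set:
  assumes "w \<in> permutations_of_set {1..n}"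
  shows "precedes w x y \<longleftrightarrow> x \<in> {1..n} \<and> y \<in> {1..n} \<and>
    ((x, y) \<in> inversion_set w \<or> (x < y \<and> (y, x) \<notin> inversion_set w))"
proof -
  have w: "distinct w" "set w = {1..n}" using assms by (auto simp: permutations_of_set_def)
  show ?thesis
    using precedes_total[of x w y] precedes_asym[of w x y] precedes_in_set[of w x y]
      precedes_irrefl[of w x] w
    by (cases x y rule: linorder_cases) (auto simp: inversion_set_iff)
qed

text \<open>Closedness is transitivity of the word order. For coclosedness, \<open>y\<close> stands
  either after \<open>x\<close>, or before \<open>x\<close> and then also before
  \<open>z\<close>.\<close>

lemma biclosed_inversion_set:
  assumes "w \<in> permutations_of_set {1..n}"
  shows "biclosed n (inversion_set w)"
proof -
  have w: "distinct w" "set w = {1..n}" using assms by (auto simp: permutations_of_set_def)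
  have "trans (inversion_set w)"
    by (rule transI) (use precedes_trans[OF w(1)] in \<open>auto simp only: inversion_set_iff\<close>)
  moreover have "(x, y) \<in> inversion_set w \<or> (y, z) \<in> inversion_set w"
    if "(x, z) \<in> inversion_set w" "z < y" "y < x" for x y z
    using that w precedes_in_set[of w x z] precedes_total[of x w y]
      precedes_trans[OF w(1), of y x z]
    by (auto simp: inversion_set_iff)
  moreover have "x \<in> {1..n} \<and> y \<in> {1..n} \<and> y < x" if "(x, y) \<in> inversion_set w" for x y
    using that precedes_in_set[of w x y] w(2) by (simp add: inversion_set_iff)
  ultimately show ?thesis unfolding biclosed_def by blast
qed

text \<open>The set \<open>I\<close> prescribes the order of every two values: decreasing if the
  pair lies in \<open>I\<close>, increasing otherwise. Biclosedness makes this relation a linear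
  order, and its word is unique because the inversion set determines the order.\<close>

lemma biclosed_ex_word:
  assumes "biclosed n I"
  shows "\<exists>!w. w \<in> permutations_of_set {1..n} \<and> inversion_set w = I"
proof -
  have sub: "x \<in> {1..n} \<and> y \<in> {1..n} \<and> y < x" if "(x, y) \<in> I" for x y
    using assms that unfolding biclosed_def by auto
  have tr: "(x, z) \<in> I" if "(x, y) \<in> I" "(y, z) \<in> I" for x y z
    using assms that unfolding biclosed_def trans_def by blast
  have co: "(x, y) \<in> I \<or> (y, z) \<in> I" if "(x, z) \<in> I" "z < y" "y < x" for x y z
    using assms that unfolding biclosed_def by blast
  define R where "R x y \<longleftrightarrow> (x, y) \<in> I \<or> (x < y \<and> (y, x) \<notin> I)" for x y
  have gt: "R x y \<longleftrightarrow> (x, y) \<in> I" if "y < x" for x y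
    using that by (auto simp: R_def)
  have lt: "R x y \<longleftrightarrow> (y, x) \<notin> I" if "x < y" for x y
    using that sub[of x y] by (auto simp: R_def)
  have irrefl: "\<not> R x x" for x using sub by (auto simp: R_def)
  have R_trans: "R x z" if "R x y" "R y z" for x y z
  proof -
    \<comment> \<open>After the three degenerate cases come the six relative orders of the values;
      three of them follow from transitivity of \<open>I\<close> (\<open>tr\<close>) and three from
      coclosedness (\<open>co\<close>).\<close>
    consider "x = y" | "y = z" | "x = z" | "x < y" "y < z" | "x < z" "z < y" | "y < x" "x < z"
      | "y < z" "z < x" | "z < x" "x < y" | "z < y" "y < x" by linarith
    then show ?thesis
    proof cases
      case 3
      then show ?thesis using that gt lt irrefl by (metis linorder_neqE_nat)
    next
      case 4
      then show ?thesis using that lt[of x y] lt[of y z] lt[of x z] co[of z x y] by auto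
    next
      case 5
      then show ?thesis using that lt[of x y] gt[of z y] lt[of x z] tr[of y z x] by auto
    next
      case 6
      then show ?thesis using that gt[of y x] lt[of y z] lt[of x z] tr[of z x y] by auto
    next
      case 7
      then show ?thesis using that gt[of y x] lt[of y z] gt[of z x] co[of x y z] by auto
    next
      case 8
      then show ?thesis using that lt[of x y] gt[of z y] gt[of z x] co[of y z x] by auto
    next
      case 9
      then show ?thesis using that gt[of y x] gt[of z y] gt[of z x] tr[of x y z] by auto
    qed (use that irrefl in auto)
  qed
  have R_total: "R x y \<or> R y x" if "x \<noteq> y" for x y
    using that by (cases x y rule: linorder_cases) (auto simp: gt lt)
  obtain w where w: "set w = {1..n}" "distinct w"
    "\<And>x y. precedes w x y \<longleftrightarrow> x \<in> {1..n} \<and> y \<in> {1..n} \<and> R x y"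
  proof (rule linear_order_word[of "{1..n}" R])
    show "R x z" if "R x y" "R y z" for x y z using R_trans[OF that] .
    show "\<not> R x x" for x by (rule irrefl)
    show "R x y \<or> R y x" if "x \<noteq> y" for x y by (rule R_total[OF that])
  qed simp_all
  have wI: "inversion_set w = I"
  proof (rule Set.set_eqI)
    fix p show "p \<in> inversion_set w \<longleftrightarrow> p \<in> I"
      using sub[of "fst p" "snd p"] gt[of "snd p" "fst p"]
      by (cases p) (auto simp only: inversion_set_iff w(3) fst_conv snd_conv)
  qed
  have wP: "w \<in> permutations_of_set {1..n}" using w by (auto simp: permutations_of_set_def)
  show ?thesis
  proof (rule ex1I[of _ w])
    fix v assume v: "v \<in> permutations_of_set {1..n} \<and> inversion_set v = I"
    then have vP: "v \<in> permutations_of_set {1..n}" and vI: "inversion_set v = I" by auto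
    show "v = w"
    proof (rule precedes_unique)
      show "distinct v" "distinct w" "set v = set w"
        using permutations_of_setD[OF vP] w by simp_all
      show "precedes w x y" if "precedes v x y" for x y
        using that by (simp only: precedes_iff_inversion_set[OF vP]
          precedes_iff_inversion_set[OF wP] vI wI)
    qed
  qed (simp only: wI wP)
qed

lemma inversion_set_inj:
  assumes "u \<in> permutations_of_set {1..n}" "v \<in> permutations_of_set {1..n}"
    "inversion_set u = inversion_set v"
  shows "u = v"
  using ex1E[OF biclosed_ex_word[OF biclosed_inversion_set[OF assms(1)]]] assms by metis

section \<open>Joins and meets through inversion sets\<close>

lemma biclosed_complement:
  assumes "biclosed n I"
  shows "biclosed n ({(x, y). x \<in> {1..n} \<and> y \<in> {1..n} \<and> y < x} - I)"
    (is "biclosed n (?D - I)")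
proof -
  have tr: "(x, z) \<in> I" if "(x, y) \<in> I" "(y, z) \<in> I" for x y z
    using assms that unfolding biclosed_def trans_def by blast
  have co: "(x, y) \<in> I \<or> (y, z) \<in> I" if "(x, z) \<in> I" "z < y" "y < x" for x y z
    using assms that unfolding biclosed_def by blast
  have "trans (?D - I)"
  proof (rule transI)
    fix x y z assume "(x, y) \<in> ?D - I" "(y, z) \<in> ?D - I"
    then show "(x, z) \<in> ?D - I" using co[of x z y] by auto
  qed
  moreover have "(x, y) \<in> ?D - I \<or> (y, z) \<in> ?D - I"
    if "(x, z) \<in> ?D - I" "z < y" "y < x" for x y z
    using that tr[of x y z] by auto
  ultimately show ?thesis unfolding biclosed_def by blast
qed

text \<open>Coclosedness survives the transitive closure by induction along a chain from
  \<open>x\<close> down to \<open>z\<close> whose last intermediate value is \<open>w\<close>: a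
  value \<open>y\<close> above \<open>w\<close> is covered by the induction hypothesis, one below
  \<open>w\<close> by coclosedness of the set containing \<open>(w, z)\<close>.\<close>

lemma biclosed_trancl_Un:
  assumes "biclosed n I" "biclosed n J"
  shows "biclosed n ((I \<union> J)\<^sup>+)"
proof -
  let ?K = "(I \<union> J)\<^sup>+" and ?D = "{(x, y). x \<in> {1..n} \<and> y \<in> {1..n} \<and> y < x}"
  have "trans ?D" by (auto simp: trans_def)
  moreover have IJ: "I \<union> J \<subseteq> ?D" using assms unfolding biclosed_def by auto
  ultimately have D: "?K \<subseteq> ?D" using trancl_mono_subset[OF IJ] by (simp only: trancl_id)
  have "(x, y) \<in> ?K \<or> (y, z) \<in> ?K" if "(x, z) \<in> ?K" "z < y" "y < x" for x y z
    using that
  proof (induction arbitrary: y rule: trancl_induct)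
    case (base z)
    then have "(x, y) \<in> I \<union> J \<or> (y, z) \<in> I \<union> J" using assms unfolding biclosed_def by blast
    then show ?case by blast
  next
    case (step w z)
    consider "y = w" | "w < y" | "y < w" by linarith
    then show ?case
    proof cases
      case 2
      then show ?thesis using step.IH[of y] step.prems step.hyps by (meson trancl_into_trancl)
    next
      case 3
      then have "(w, y) \<in> I \<union> J \<or> (y, z) \<in> I \<union> J"
        using step.prems step.hyps assms unfolding biclosed_def by blast
      then show ?thesis using step.hyps by (meson r_into_trancl trancl_into_trancl)
    qed (use step.hyps in simp)
  qed
  then show ?thesis using D unfolding biclosed_def by auto
qed

text \<open>Every upper bound of \<open>u\<close> and \<open>v\<close> has a transitive inversion
  set, so the transitive closure of the union belongs to the join. Complementation turns this into a
  construction of meets.\<close>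

lemma lattice_weak_order: "lattice (weak_order n)"
proof -
  let ?P = "permutations_of_set {1..n}" and ?D = "{(x, y). x \<in> {1..n} \<and> y \<in> {1..n} \<and> y < x}"
  interpret partial_order "weak_order n"
    by unfold_locales (auto simp: weak_order_def intro: inversion_set_inj)
  have sup: "\<exists>s. least (weak_order n) s (Upper (weak_order n) {u, v})"
    if "u \<in> ?P" "v \<in> ?P" for u v
  proof -
    let ?K = "(inversion_set u \<union> inversion_set v)\<^sup>+"
    have "biclosed n ?K" using that by (simp add: biclosed_trancl_Un biclosed_inversion_set)
    then obtain s where s: "s \<in> ?P" "inversion_set s = ?K" by (meson biclosed_ex_word)
    have "?K \<subseteq> inversion_set t" if "t \<in> ?P" "inversion_set u \<subseteq> inversion_set t"
      "inversion_set v \<subseteq> inversion_set t" for t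
    proof -
      have "trans (inversion_set t)" using biclosed_inversion_set[OF that(1)] by (simp add: biclosed_def)
      then show ?thesis using that by (metis Un_least trancl_id trancl_mono_subset)
    qed
    then have "least (weak_order n) s (Upper (weak_order n) {u, v})"
      using s that by (auto simp: least_def Upper_def weak_order_def)
    then show ?thesis by blast
  qed
  have inf: "\<exists>s. greatest (weak_order n) s (Lower (weak_order n) {u, v})"
    if uv: "u \<in> ?P" "v \<in> ?P" for u v
  proof -
    \<comment> \<open>The non-inversions of the meet: the join construction applied to the
      complements.\<close>
    let ?K = "((?D - inversion_set u) \<union> (?D - inversion_set v))\<^sup>+"
    have K: "biclosed n ?K"
      using that by (simp only: biclosed_trancl_Un biclosed_inversion_set biclosed_complement)
    then have "\<exists>s. s \<in> ?P \<and> inversion_set s = ?D - ?K"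
      by (intro ex1_implies_ex biclosed_ex_word biclosed_complement)
    then obtain s where s: "s \<in> ?P" "inversion_set s = ?D - ?K" by blast
    have sub: "inversion_set t \<subseteq> ?D" if "t \<in> ?P" for t
      using biclosed_inversion_set[OF that] by (simp add: biclosed_def)
    have "inversion_set t \<subseteq> ?D - ?K" if "t \<in> ?P" "inversion_set t \<subseteq> inversion_set u"
      "inversion_set t \<subseteq> inversion_set v" for t
    proof -
      have "trans (?D - inversion_set t)"
        using biclosed_complement[OF biclosed_inversion_set[OF that(1)]] by (simp add: biclosed_def)
      then have "?K \<subseteq> ?D - inversion_set t"
        using that trancl_mono_subset[of "(?D - inversion_set u) \<union> (?D - inversion_set v)" "?D - inversion_set t"]
        by (auto simp only: trancl_id)
      then show ?thesis using sub[OF that(1)] by blast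
    qed
    moreover have "?D - ?K \<subseteq> inversion_set u" "?D - ?K \<subseteq> inversion_set v" by blast+
    ultimately have "greatest (weak_order n) s (Lower (weak_order n) {u, v})"
      using s uv by (auto simp: greatest_def Lower_def weak_order_def)
    then show ?thesis by blast
  qed
  show ?thesis
    by unfold_locales (use sup inf in \<open>simp_all add: weak_order_def\<close>)
qed

section \<open>Ordered partitions as intervals\<close>

text \<open>An element of no block gets the length of the list; with this default,
  \<open>block_index_append\<close> holds for every \<open>x\<close>.\<close>

primrec block_index :: "'a set list \<Rightarrow> 'a \<Rightarrow> nat" where
  "block_index [] x = 0"
| "block_index (A # F) x = (if x \<in> A then 0 else Suc (block_index F x))"

lemma block_index_less: "x \<in> \<Union> (set F) \<Longrightarrow> block_index F x < length F"
  by (induction F) auto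

lemma nth_block_index: "x \<in> \<Union> (set F) \<Longrightarrow> x \<in> F ! block_index F x"
  by (induction F) auto

lemma block_index_append:
  "block_index (F @ G) x = (if x \<in> \<Union> (set F) then block_index F x else length F + block_index G x)"
  by (induction F) auto

lemma block_index_nth:
  assumes "distinct F" "disjoint (set F)" "i < length F" "x \<in> F ! i"
  shows "block_index F x = i"
  using assms
proof (induction F arbitrary: i)
  case (Cons A F)
  then show ?case
  proof (cases i)
    case (Suc j)
    then have "F ! j \<in> set F" using Cons.prems by simp
    then have "A \<inter> F ! j = {}"
      using Cons.prems by (auto simp: disjoint_def)
    then have "x \<notin> A" using Cons.prems Suc by auto
    moreover have "disjoint (set F)" using Cons.prems(2) by (simp add: disjoint_def)
    ultimately show ?thesis using Cons Suc by simp
  qed simp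
qed simp

lemma words_Cons:
  "w \<in> words (A # F) \<longleftrightarrow> (\<exists>u v. w = u @ v \<and> u \<in> permutations_of_set A \<and> v \<in> words F)"
proof
  assume "w \<in> words (A # F)"
  then obtain u us where "w = concat (u # us)" "u \<in> permutations_of_set A"
    "us \<in> listset (map permutations_of_set F)"
    unfolding words_def by (auto simp: set_Cons_def)
  then have "w = u @ concat us" "u \<in> permutations_of_set A" "concat us \<in> words F"
    unfolding words_def by simp_all
  then show "\<exists>u v. w = u @ v \<and> u \<in> permutations_of_set A \<and> v \<in> words F" by blast
next
  assume "\<exists>u v. w = u @ v \<and> u \<in> permutations_of_set A \<and> v \<in> words F"
  then obtain u us where "w = concat (u # us)" "u \<in> permutations_of_set A"
    "us \<in> listset (map permutations_of_set F)"
    unfolding words_def by auto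
  then show "w \<in> words (A # F)"
    unfolding words_def by (intro image_eqI[of _ concat "u # us"]) (simp_all add: set_Cons_def)
qed

lemma sorted_wrt_filter_append:
  assumes "sorted_wrt (\<lambda>x y. P y \<longrightarrow> P x) w"
  shows "w = filter P w @ filter (\<lambda>x. \<not> P x) w"
  using assms
proof (induction w)
  case (Cons a w)
  show ?case
  proof (cases "P a")
    case False
    then have "filter P (a # w) = []" using Cons.prems by (auto simp: filter_empty_conv)
    then show ?thesis using False by (auto simp: filter_empty_conv filter_id_conv)
  qed (use Cons in auto)
qed simp

text \<open>Turns concatenation into a sortedness condition. The elements of the first block are
  those of index 0, so in a sorted word they form a prefix, and on the rest all indices are shifted
  by one.\<close>

lemma words_iff:
  assumes "distinct F" "disjoint (set F)"
  shows "w \<in> words F \<longleftrightarrow> w \<in> permutations_of_set (\<Union> (set F)) \<and>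
    sorted_wrt (\<lambda>x y. block_index F x \<le> block_index F y) w"
  using assms
proof (induction F arbitrary: w)
  case Nil
  then show ?case by (auto simp: words_def)
next
  case (Cons A F)
  have dis: "A \<inter> \<Union> (set F) = {}" using Cons.prems by (auto simp: disjoint_def)
  have "disjoint (set F)" using Cons.prems(2) by (simp add: disjoint_def)
  then have IH: "v \<in> words F \<longleftrightarrow> v \<in> permutations_of_set (\<Union> (set F)) \<and>
    sorted_wrt (\<lambda>x y. block_index F x \<le> block_index F y) v" for v
    using Cons by simp
  let ?R = "\<lambda>x y. block_index (A # F) x \<le> block_index (A # F) y"
  show ?case
  proof
    assume "w \<in> words (A # F)"
    then obtain u v where w: "w = u @ v" and u: "set u = A" "distinct u"
      and v: "set v = \<Union> (set F)" "distinct v" "sorted_wrt (\<lambda>x y. block_index F x \<le> block_index F y) v"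
      by (auto simp: words_Cons IH permutations_of_set_def)
    have "sorted_wrt ?R u" using u(1) by (auto simp: sorted_wrt_iff_nth_less)
    moreover have "sorted_wrt ?R v"
      by (rule sorted_wrt_mono_rel[OF _ v(3)]) (use v(1) dis in auto)
    ultimately show "w \<in> permutations_of_set (\<Union> (set (A # F))) \<and> sorted_wrt ?R w"
      using w u v dis by (auto simp: permutations_of_set_def sorted_wrt_append)
  next
    assume w: "w \<in> permutations_of_set (\<Union> (set (A # F))) \<and> sorted_wrt ?R w"
    define u v where "u = filter (\<lambda>x. x \<in> A) w" and "v = filter (\<lambda>x. x \<notin> A) w"
    have "sorted_wrt (\<lambda>x y. y \<in> A \<longrightarrow> x \<in> A) w"
      by (rule sorted_wrt_mono_rel[of _ ?R]) (use w in \<open>auto split: if_splits\<close>)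
    then have "w = u @ v" unfolding u_def v_def by (rule sorted_wrt_filter_append)
    moreover have "u \<in> permutations_of_set A"
      using w by (auto simp: u_def permutations_of_set_def)
    moreover have "v \<in> permutations_of_set (\<Union> (set F))"
      using w dis by (auto simp: v_def permutations_of_set_def)
    moreover have "sorted_wrt (\<lambda>x y. block_index F x \<le> block_index F y) v"
    proof (rule sorted_wrt_mono_rel[of _ ?R])
      show "sorted_wrt ?R v" using w by (simp add: v_def sorted_wrt_filter)
    qed (auto simp: v_def)
    ultimately show "w \<in> words (A # F)" unfolding words_Cons IH by blast
  qed
qed

text \<open>The pairs that every word sorted weakly by \<open>k\<close> must invert: the inversion
  set of the least such word, where ties are listed increasingly.\<close>

definition min_inversions :: "nat \<Rightarrow> (nat \<Rightarrow> nat) \<Rightarrow> (nat \<times> nat) set" where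
  "min_inversions n k = {(x, y). x \<in> {1..n} \<and> y \<in> {1..n} \<and> y < x \<and> k x < k y}"

text \<open>The pairs that such a word may invert: the inversion set of the greatest one, where ties
  are listed decreasingly.\<close>

definition max_inversions :: "nat \<Rightarrow> (nat \<Rightarrow> nat) \<Rightarrow> (nat \<times> nat) set" where
  "max_inversions n k = {(x, y). x \<in> {1..n} \<and> y \<in> {1..n} \<and> y < x \<and> k x \<le> k y}"

lemma biclosed_min_inversions: "biclosed n (min_inversions n k)"
  by (auto simp: biclosed_def min_inversions_def trans_def)

lemma biclosed_max_inversions: "biclosed n (max_inversions n k)"
  by (auto simp: biclosed_def max_inversions_def trans_def)

lemma min_inversions_subset_max: "min_inversions n k \<subseteq> max_inversions n k"
  by (auto simp: min_inversions_def max_inversions_def)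

lemma ordered_partitionD:
  assumes "ordered_partition n F"
  shows "distinct F" "disjoint (set F)" "\<Union> (set F) = {1..n}" "{} \<notin> set F"
  using assms by (auto simp: ordered_partition_def partition_on_def)

text \<open>If \<open>x\<close> precedes \<open>y\<close> against the block order, then either
  \<open>y < x\<close> and \<open>(x, y)\<close> is an inversion outside the upper bound, or
  \<open>x < y\<close> and the forced inversion \<open>(y, x)\<close> is missing.\<close>

lemma words_interval:
  assumes "ordered_partition n F"
  shows "w \<in> words F \<longleftrightarrow> w \<in> permutations_of_set {1..n} \<and>
    min_inversions n (block_index F) \<subseteq> inversion_set w \<and>
    inversion_set w \<subseteq> max_inversions n (block_index F)"
proof -
  have "sorted_wrt (\<lambda>x y. block_index F x \<le> block_index F y) w \<longleftrightarrow>
    min_inversions n (block_index F) \<subseteq> inversion_set w \<and>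
    inversion_set w \<subseteq> max_inversions n (block_index F)" (is "?L \<longleftrightarrow> ?R")
    if w: "w \<in> permutations_of_set {1..n}"
  proof
    assume ?L
    then have le: "block_index F x \<le> block_index F y" if "precedes w x y" for x y
      using that by (simp add: sorted_wrt_iff_precedes)
    show ?R
    proof (intro conjI subsetI)
      fix p assume p: "p \<in> min_inversions n (block_index F)"
      obtain x y where xy: "p = (x, y)" by (cases p)
      have "x \<in> set w" "y \<in> set w" "y < x" "\<not> precedes w y x"
        using p xy le[of y x] permutations_of_setD[OF w] by (auto simp: min_inversions_def)
      then show "p \<in> inversion_set w"
        using precedes_total[of x w y] xy by (auto simp: inversion_set_iff)
    next
      fix p assume p: "p \<in> inversion_set w"
      obtain x y where xy: "p = (x, y)" by (cases p)
      then have "precedes w x y" "y < x" using p by (simp_all add: inversion_set_iff)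
      then show "p \<in> max_inversions n (block_index F)"
        using xy le[of x y] precedes_in_set[of w x y] permutations_of_setD[OF w]
        by (simp add: max_inversions_def)
    qed
  next
    assume R: ?R
    have "block_index F x \<le> block_index F y" if "precedes w x y" for x y
    proof (rule ccontr)
      assume less: "\<not> block_index F x \<le> block_index F y"
      have xy: "x \<in> {1..n}" "y \<in> {1..n}"
        using precedes_in_set[OF that] permutations_of_setD(1)[OF w] by simp_all
      have "x \<noteq> y" using less by auto
      then consider "y < x" | "x < y" by linarith
      then show False
      proof cases
        case 1
        then have "(x, y) \<in> max_inversions n (block_index F)"
          using R that inversion_set_iff by blast
        then show False using less by (simp add: max_inversions_def)
      next
        case 2
        then have "(y, x) \<in> min_inversions n (block_index F)"
          using less xy by (simp add: min_inversions_def)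
        then have "precedes w y x" using R inversion_set_iff by blast
        then show False using that precedes_asym permutations_of_setD(2)[OF w] by metis
      qed
    qed
    then show ?L by (simp add: sorted_wrt_iff_precedes)
  qed
  then show ?thesis
    using words_iff[OF ordered_partitionD(1,2)[OF assms], of w] ordered_partitionD(3)[OF assms]
    by metis
qed

section \<open>Passing between ordered partitions and key functions\<close>

lemma image_block_index:
  assumes "ordered_partition n F"
  shows "block_index F ` {1..n} = {..<length F}"
proof
  show "block_index F ` {1..n} \<subseteq> {..<length F}"
    using block_index_less[of _ F] ordered_partitionD(3)[OF assms] by (intro image_subsetI) simp
  show "{..<length F} \<subseteq> block_index F ` {1..n}"
  proof
    fix i assume "i \<in> {..<length F}"
    then have i: "i < length F" by simp
    then have "F ! i \<noteq> {}" using ordered_partitionD(4)[OF assms] by (metis nth_mem)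
    then obtain x where x: "x \<in> F ! i" by blast
    then have "x \<in> {1..n}" using i ordered_partitionD(3)[OF assms] by (metis UnionI nth_mem)
    moreover have "i = block_index F x"
      using block_index_nth[OF ordered_partitionD(1,2)[OF assms] i x] by simp
    ultimately show "i \<in> block_index F ` {1..n}" by (rule rev_image_eqI)
  qed
qed

text \<open>The blocks are the fibres of \<open>block_index\<close>, so comparing sets of blocks
  reduces to comparing which elements share an index.\<close>

lemma set_ordered_partition:
  assumes "ordered_partition n F"
  shows "set F = (\<lambda>x. {y \<in> {1..n}. block_index F y = block_index F x}) ` {1..n}"
proof -
  have F: "{y \<in> {1..n}. block_index F y = i} = F ! i" if "i < length F" for i
  proof (intro equalityI subsetI)
    fix y assume "y \<in> {y \<in> {1..n}. block_index F y = i}"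
    then show "y \<in> F ! i" using nth_block_index[of y F] ordered_partitionD(3)[OF assms] by auto
  next
    fix y assume y: "y \<in> F ! i"
    then have "y \<in> {1..n}" using that ordered_partitionD(3)[OF assms] by (metis UnionI nth_mem)
    then show "y \<in> {y \<in> {1..n}. block_index F y = i}"
      using block_index_nth[OF ordered_partitionD(1,2)[OF assms] that y] by simp
  qed
  have "set F = (!) F ` {..<length F}" by (auto simp: set_conv_nth)
  also have "\<dots> = (\<lambda>i. {y \<in> {1..n}. block_index F y = i}) ` {..<length F}"
    by (rule image_cong[OF refl]) (use F in simp)
  also have "\<dots> = (\<lambda>i. {y \<in> {1..n}. block_index F y = i}) ` block_index F ` {1..n}"
    by (simp only: image_block_index[OF assms])
  finally show ?thesis by (simp only: image_image)
qed

text \<open>The blocks are the level sets of \<open>k\<close>, listed by increasing value. The index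
  of \<open>x\<close> is then the position of \<open>k x\<close> in the strictly sorted list of
  values, so indices compare as keys do.\<close>

lemma ordered_partition_of_key:
  fixes k :: "nat \<Rightarrow> nat"
  obtains F where "ordered_partition n F" "length F = card (k ` {1..n})"
    "\<And>x y. x \<in> {1..n} \<Longrightarrow> y \<in> {1..n} \<Longrightarrow> block_index F x < block_index F y \<longleftrightarrow> k x < k y"
proof -
  define vs where "vs = sorted_list_of_set (k ` {1..n})"
  define B where "B v = {x \<in> {1..n}. k x = v}" for v
  define F where "F = map B vs"
  have vs: "set vs = k ` {1..n}" "distinct vs" "sorted_wrt (<) vs"
    by (auto simp: vs_def)
  have inj: "inj_on B (set vs)" unfolding vs(1) B_def by (rule inj_onI) force
  have op: "ordered_partition n F"
    unfolding ordered_partition_def partition_on_def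
  proof (intro conjI)
    show "distinct F" using inj vs(2) by (simp add: F_def distinct_map)
    show "\<Union> (set F) = {1..n}" by (auto simp: F_def B_def vs(1))
    show "disjoint (set F)" by (auto simp: F_def B_def disjoint_def)
    show "{} \<notin> set F" by (force simp: F_def B_def vs(1))
  qed
  have key: "vs ! block_index F x = k x" "block_index F x < length vs" if "x \<in> {1..n}" for x
  proof -
    have x: "x \<in> \<Union> (set F)" using that ordered_partitionD(3)[OF op] by simp
    show "block_index F x < length vs" using block_index_less[OF x] by (simp add: F_def)
    then show "vs ! block_index F x = k x" using nth_block_index[OF x] by (simp add: F_def B_def)
  qed
  show thesis
  proof (rule that[OF op])
    show "length F = card (k ` {1..n})" by (simp add: F_def vs_def)
    fix x y assume xy: "x \<in> {1..n}" "y \<in> {1..n}"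
    show "block_index F x < block_index F y \<longleftrightarrow> k x < k y"
      using key[OF xy(1)] key[OF xy(2)] sorted_wrt_nth_less[OF vs(3)]
      by (metis linorder_less_linear order.asym)
  qed
qed

section \<open>Congruences and betweenness\<close>

text \<open>The description denotes a word when \<open>I\<close> is biclosed, since exactly one
  permutation then has this inversion set.\<close>

definition word_of :: "nat \<Rightarrow> (nat \<times> nat) set \<Rightarrow> nat list" where
  "word_of n I = (THE w. w \<in> permutations_of_set {1..n} \<and> inversion_set w = I)"

lemma word_of:
  assumes "biclosed n I"
  shows "word_of n I \<in> permutations_of_set {1..n}" "inversion_set (word_of n I) = I"
  using theI'[OF biclosed_ex_word[OF assms]] by (simp_all add: word_of_def)

locale weak_order_congruence =
  fixes n :: nat and r :: "(nat list \<times> nat list) set"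
  assumes congruence: "lattice_congruence (weak_order n) r"
begin

sublocale lattice "weak_order n"
  by (rule lattice_weak_order)

lemma carrier_weak_order: "carrier (weak_order n) = permutations_of_set {1..n}"
  and le_weak_order: "u \<sqsubseteq>\<^bsub>weak_order n\<^esub> v \<longleftrightarrow> inversion_set u \<subseteq> inversion_set v"
  by (simp_all add: weak_order_def)

lemma r_equiv: "equiv (carrier (weak_order n)) r"
  using congruence by (simp add: lattice_congruence_def)

lemma r_refl: "u \<in> carrier (weak_order n) \<Longrightarrow> (u, u) \<in> r"
  using r_equiv by (simp add: equiv_def refl_on_def)

lemma r_sym: "(u, v) \<in> r \<Longrightarrow> (v, u) \<in> r"
  using r_equiv by (auto simp: equiv_def sym_def)

lemma r_trans: "(u, v) \<in> r \<Longrightarrow> (v, w) \<in> r \<Longrightarrow> (u, w) \<in> r"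
  using r_equiv by (auto simp: equiv_def trans_def)

lemma r_carrier: "(u, v) \<in> r \<Longrightarrow> u \<in> carrier (weak_order n) \<and> v \<in> carrier (weak_order n)"
  using r_equiv by (auto simp: equiv_def refl_on_def)

lemma r_join: "(u, u') \<in> r \<Longrightarrow> (v, v') \<in> r \<Longrightarrow>
    (u \<squnion>\<^bsub>weak_order n\<^esub> v, u' \<squnion>\<^bsub>weak_order n\<^esub> v') \<in> r"
  and r_meet: "(u, u') \<in> r \<Longrightarrow> (v, v') \<in> r \<Longrightarrow>
    (u \<sqinter>\<^bsub>weak_order n\<^esub> v, u' \<sqinter>\<^bsub>weak_order n\<^esub> v') \<in> r"
  using congruence by (simp_all add: lattice_congruence_def)

lemma join_eq:
  assumes "u \<sqsubseteq>\<^bsub>weak_order n\<^esub> v" "u \<in> carrier (weak_order n)" "v \<in> carrier (weak_order n)"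
  shows "u \<squnion>\<^bsub>weak_order n\<^esub> v = v"
  \<comment> \<open>Despite their names, \<open>le_iff_meet\<close> characterizes the order by joins
    and \<open>le_iff_join\<close> by meets.\<close>
  using le_iff_meet[OF assms(2,3)] assms(1) by (rule iffD1)

lemma meet_eq:
  assumes "u \<sqsubseteq>\<^bsub>weak_order n\<^esub> v" "u \<in> carrier (weak_order n)" "v \<in> carrier (weak_order n)"
  shows "u \<sqinter>\<^bsub>weak_order n\<^esub> v = u"
  by (rule iffD1[OF le_iff_join[OF assms(2,3)] assms(1), symmetric])

text \<open>Congruence puts the meet \<open>q\<close> and the join \<open>p\<close> of
  \<open>a\<close> and \<open>b\<close> into the class of \<open>a\<close>. Joining \<open>q\<close>
  and \<open>p\<close> with \<open>c\<close> gives \<open>c\<close> and \<open>p\<close>, so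
  \<open>c\<close> lies in that class too.\<close>

lemma r_between:
  assumes "(a, b) \<in> r" and c: "c \<in> carrier (weak_order n)"
    and le: "a \<sqinter>\<^bsub>weak_order n\<^esub> b \<sqsubseteq>\<^bsub>weak_order n\<^esub> c" "c \<sqsubseteq>\<^bsub>weak_order n\<^esub> a \<squnion>\<^bsub>weak_order n\<^esub> b"
  shows "(a, c) \<in> r"
proof -
  define p q where "p = a \<squnion>\<^bsub>weak_order n\<^esub> b" and "q = a \<sqinter>\<^bsub>weak_order n\<^esub> b"
  have ab: "a \<in> carrier (weak_order n)" "b \<in> carrier (weak_order n)"
    using r_carrier[OF assms(1)] by auto
  then have pq: "p \<in> carrier (weak_order n)" "q \<in> carrier (weak_order n)"
    by (simp_all add: p_def q_def)
  have "(a, p) \<in> r" using r_join[OF r_refl[OF ab(1)] assms(1)] join_eq[of a a] ab by (simp add: p_def)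
  moreover have "(a, q) \<in> r" using r_meet[OF r_refl[OF ab(1)] assms(1)] meet_eq[of a a] ab by (simp add: q_def)
  ultimately have "(q, p) \<in> r" using r_sym r_trans by blast
  then have "(q \<squnion>\<^bsub>weak_order n\<^esub> c, p \<squnion>\<^bsub>weak_order n\<^esub> c) \<in> r" using r_join r_refl c by blast
  moreover have "q \<squnion>\<^bsub>weak_order n\<^esub> c = c" using le(1) join_eq c pq by (simp add: q_def)
  moreover have "p \<squnion>\<^bsub>weak_order n\<^esub> c = p"
    using le(2) join_eq[of c p] c pq join_comm[of "weak_order n" p c] by (simp add: p_def)
  ultimately show ?thesis using \<open>(a, p) \<in> r\<close> r_sym r_trans by metis
qed

text \<open>The meet has at most the inversions in \<open>I \<inter> J\<close> and the join at least
  those in \<open>I \<union> J\<close>, so the assumed inclusions place the word of \<open>K\<close>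
  between meet and join.\<close>

lemma word_of_between:
  assumes "(word_of n I, word_of n J) \<in> r" and bc: "biclosed n I" "biclosed n J" "biclosed n K"
    and "I \<inter> J \<subseteq> K" "K \<subseteq> I \<union> J"
  shows "(word_of n I, word_of n K) \<in> r"
proof (rule r_between[OF assms(1)])
  let ?a = "word_of n I" and ?b = "word_of n J"
  have ab: "?a \<in> carrier (weak_order n)" "?b \<in> carrier (weak_order n)"
    using word_of(1)[OF bc(1)] word_of(1)[OF bc(2)] by (simp_all only: carrier_weak_order)
  show "word_of n K \<in> carrier (weak_order n)"
    using word_of(1)[OF bc(3)] by (simp only: carrier_weak_order)
  have "inversion_set (?a \<sqinter>\<^bsub>weak_order n\<^esub> ?b) \<subseteq> I \<inter> J"
    using meet_left[OF ab] meet_right[OF ab]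
    by (simp only: le_weak_order word_of(2)[OF bc(1)] word_of(2)[OF bc(2)] Int_subset_iff)
  then show "?a \<sqinter>\<^bsub>weak_order n\<^esub> ?b \<sqsubseteq>\<^bsub>weak_order n\<^esub> word_of n K"
    using assms(5) unfolding le_weak_order word_of(2)[OF bc(3)] by blast
  have "I \<union> J \<subseteq> inversion_set (?a \<squnion>\<^bsub>weak_order n\<^esub> ?b)"
    using join_left[OF ab] join_right[OF ab]
    by (simp only: le_weak_order word_of(2)[OF bc(1)] word_of(2)[OF bc(2)] Un_subset_iff)
  then show "word_of n K \<sqsubseteq>\<^bsub>weak_order n\<^esub> ?a \<squnion>\<^bsub>weak_order n\<^esub> ?b"
    using assms(6) unfolding le_weak_order word_of(2)[OF bc(3)] by blast
qed

text \<open>Equivalence of the two extreme words, phrased for keys so that betweenness can be tested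
  by comparing numbers.\<close>

definition key_equiv :: "(nat \<Rightarrow> nat) \<Rightarrow> (nat \<Rightarrow> nat) \<Rightarrow> bool" where
  "key_equiv k l \<longleftrightarrow>
    (word_of n (min_inversions n k), word_of n (min_inversions n l)) \<in> r \<and>
    (word_of n (max_inversions n k), word_of n (max_inversions n l)) \<in> r"

text \<open>The two assumptions say that the strict order of \<open>m\<close> contains the
  intersection and lies in the union of those of \<open>k\<close> and \<open>l\<close>; this bounds
  both kinds of inversion sets as \<open>word_of_between\<close> requires.\<close>

lemma key_equiv_between:
  assumes "key_equiv k l"
    and "\<And>x y. x \<in> {1..n} \<Longrightarrow> y \<in> {1..n} \<Longrightarrow> k x < k y \<Longrightarrow> l x < l y \<Longrightarrow> m x < m y"
    and "\<And>x y. x \<in> {1..n} \<Longrightarrow> y \<in> {1..n} \<Longrightarrow> m x < m y \<Longrightarrow> k x < k y \<or> l x < l y"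
  shows "key_equiv k m"
proof -
  have "(word_of n (min_inversions n k), word_of n (min_inversions n m)) \<in> r"
  proof (rule word_of_between)
    show "(word_of n (min_inversions n k), word_of n (min_inversions n l)) \<in> r"
      using assms(1) by (simp only: key_equiv_def)
    show "min_inversions n k \<inter> min_inversions n l \<subseteq> min_inversions n m"
      unfolding min_inversions_def by (safe, rule assms(2))
    show "min_inversions n m \<subseteq> min_inversions n k \<union> min_inversions n l"
      unfolding min_inversions_def using assms(3) by blast
  qed (rule biclosed_min_inversions)+
  moreover have "(word_of n (max_inversions n k), word_of n (max_inversions n m)) \<in> r"
  proof (rule word_of_between)
    show "(word_of n (max_inversions n k), word_of n (max_inversions n l)) \<in> r"
      using assms(1) by (simp only: key_equiv_def)
    \<comment> \<open>A weak comparison is the negation of the reversed strict one. Contraposition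
      exchanges the roles of the assumptions: the union bound on \<open>m\<close> yields this
      inclusion, the intersection bound the next.\<close>
    show "max_inversions n k \<inter> max_inversions n l \<subseteq> max_inversions n m"
    proof (clarsimp simp: max_inversions_def simp del: One_nat_def atLeastAtMost_iff)
      fix x y assume "x \<in> {1..n}" "y \<in> {1..n}" "k x \<le> k y" "l x \<le> l y"
      then show "m x \<le> m y" using assms(3)[of y x] by linarith
    qed
    show "max_inversions n m \<subseteq> max_inversions n k \<union> max_inversions n l"
    proof (clarsimp simp: max_inversions_def simp del: One_nat_def atLeastAtMost_iff)
      fix x y assume "x \<in> {1..n}" "y \<in> {1..n}" "m x \<le> m y" "\<not> l x \<le> l y"
      then show "k x \<le> k y" using assms(2)[of y x] by linarith
    qed
  qed (rule biclosed_max_inversions)+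
  ultimately show ?thesis unfolding key_equiv_def ..
qed

section \<open>Equivalence of ordered partitions through their least and greatest words\<close>

definition min_word :: "nat set list \<Rightarrow> nat list" where
  "min_word F = word_of n (min_inversions n (block_index F))"

definition max_word :: "nat set list \<Rightarrow> nat list" where
  "max_word F = word_of n (max_inversions n (block_index F))"

lemma min_word: "min_word F \<in> carrier (weak_order n)"
    "inversion_set (min_word F) = min_inversions n (block_index F)"
  and max_word: "max_word F \<in> carrier (weak_order n)"
    "inversion_set (max_word F) = max_inversions n (block_index F)"
  unfolding min_word_def max_word_def carrier_weak_order
  by (rule word_of biclosed_min_inversions biclosed_max_inversions)+

lemma min_word_le_max_word: "min_word F \<sqsubseteq>\<^bsub>weak_order n\<^esub> max_word F"
  by (simp only: le_weak_order min_word max_word min_inversions_subset_max)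

lemma key_equiv_block_index: "key_equiv (block_index F) (block_index G) \<longleftrightarrow>
    (min_word F, min_word G) \<in> r \<and> (max_word F, max_word G) \<in> r"
  by (simp only: key_equiv_def min_word_def max_word_def)

lemma words_iff_between:
  assumes "ordered_partition n F"
  shows "w \<in> words F \<longleftrightarrow> w \<in> carrier (weak_order n) \<and>
    min_word F \<sqsubseteq>\<^bsub>weak_order n\<^esub> w \<and> w \<sqsubseteq>\<^bsub>weak_order n\<^esub> max_word F"
  using words_interval[OF assms] by (simp only: le_weak_order min_word max_word carrier_weak_order)

lemma min_word_in_words: "ordered_partition n F \<Longrightarrow> min_word F \<in> words F"
  and max_word_in_words: "ordered_partition n F \<Longrightarrow> max_word F \<in> words F"
  using min_word max_word min_word_le_max_word by (simp_all add: words_iff_between)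

text \<open>The least word of \<open>F\<close> is equivalent to some \<open>v\<close> above the
  least word of \<open>G\<close>. Joining with the latter leaves \<open>v\<close> fixed, so the
  least word of \<open>F\<close> is equivalent to the join of both least words. By symmetry so is
  that of \<open>G\<close>; the greatest words are treated dually.\<close>

lemma op_equiv_imp_key_equiv:
  assumes F: "ordered_partition n F" and G: "ordered_partition n G" and eq: "op_equiv r F G"
  shows "key_equiv (block_index F) (block_index G)"
proof -
  obtain v where v: "v \<in> words G" "(min_word F, v) \<in> r"
    using eq min_word_in_words[OF F] unfolding op_equiv_def by meson
  obtain v' where v': "v' \<in> words F" "(min_word G, v') \<in> r"
    using eq min_word_in_words[OF G] unfolding op_equiv_def by meson
  obtain w where w: "w \<in> words G" "(max_word F, w) \<in> r"
    using eq max_word_in_words[OF F] unfolding op_equiv_def by meson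
  obtain w' where w': "w' \<in> words F" "(max_word G, w') \<in> r"
    using eq max_word_in_words[OF G] unfolding op_equiv_def by meson
  note in_G = v(1)[unfolded words_iff_between[OF G]] w(1)[unfolded words_iff_between[OF G]]
  note in_F = v'(1)[unfolded words_iff_between[OF F]] w'(1)[unfolded words_iff_between[OF F]]
  have "(min_word G \<squnion>\<^bsub>weak_order n\<^esub> min_word F, min_word G \<squnion>\<^bsub>weak_order n\<^esub> v) \<in> r"
    by (rule r_join[OF r_refl[OF min_word(1)] v(2)])
  moreover have "min_word G \<squnion>\<^bsub>weak_order n\<^esub> v = v"
    using in_G by (intro join_eq min_word) auto
  moreover have "(min_word F \<squnion>\<^bsub>weak_order n\<^esub> min_word G, min_word F \<squnion>\<^bsub>weak_order n\<^esub> v') \<in> r"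
    by (rule r_join[OF r_refl[OF min_word(1)] v'(2)])
  moreover have "min_word F \<squnion>\<^bsub>weak_order n\<^esub> v' = v'"
    using in_F by (intro join_eq min_word) auto
  ultimately have "(min_word F, min_word G) \<in> r"
    using v(2) v'(2) join_comm[of "weak_order n" "min_word F" "min_word G"] by (metis r_sym r_trans)
  have "(w \<sqinter>\<^bsub>weak_order n\<^esub> max_word G, max_word F \<sqinter>\<^bsub>weak_order n\<^esub> max_word G) \<in> r"
    by (rule r_meet[OF r_sym[OF w(2)] r_refl[OF max_word(1)]])
  moreover have "w \<sqinter>\<^bsub>weak_order n\<^esub> max_word G = w"
    using in_G by (intro meet_eq max_word) auto
  moreover have "(w' \<sqinter>\<^bsub>weak_order n\<^esub> max_word F, max_word G \<sqinter>\<^bsub>weak_order n\<^esub> max_word F) \<in> r"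
    by (rule r_meet[OF r_sym[OF w'(2)] r_refl[OF max_word(1)]])
  moreover have "w' \<sqinter>\<^bsub>weak_order n\<^esub> max_word F = w'"
    using in_F by (intro meet_eq max_word) auto
  ultimately have "(max_word F, max_word G) \<in> r"
    using w(2) w'(2) meet_comm[of "weak_order n" "max_word F" "max_word G"] by (metis r_sym r_trans)
  with \<open>(min_word F, min_word G) \<in> r\<close> show ?thesis by (simp only: key_equiv_block_index)
qed

text \<open>The witness pushes \<open>v\<close> into the interval of \<open>G\<close> by a join with
  its least and a meet with its greatest word. The same operation with the extreme words of
  \<open>F\<close> fixes \<open>v\<close>, and the congruence relates the two results.\<close>

lemma key_equiv_imp_words:
  assumes F: "ordered_partition n F" and G: "ordered_partition n G"
    and eq: "(min_word F, min_word G) \<in> r" "(max_word F, max_word G) \<in> r" and v: "v \<in> words F"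
  shows "\<exists>w\<in>words G. (v, w) \<in> r"
proof
  let ?w = "(min_word G \<squnion>\<^bsub>weak_order n\<^esub> v) \<sqinter>\<^bsub>weak_order n\<^esub> max_word G"
  have vF: "v \<in> carrier (weak_order n)" "min_word F \<sqsubseteq>\<^bsub>weak_order n\<^esub> v"
    "v \<sqsubseteq>\<^bsub>weak_order n\<^esub> max_word F"
    using v by (simp_all only: words_iff_between[OF F])
  have j: "min_word G \<squnion>\<^bsub>weak_order n\<^esub> v \<in> carrier (weak_order n)"
    "min_word G \<sqsubseteq>\<^bsub>weak_order n\<^esub> min_word G \<squnion>\<^bsub>weak_order n\<^esub> v"
    using min_word(1) vF(1) by (simp_all add: join_left)
  have "min_word G \<sqsubseteq>\<^bsub>weak_order n\<^esub> ?w"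
    by (rule meet_le) (use j min_word(1) max_word(1) min_word_le_max_word in auto)
  then show "?w \<in> words G"
    using j max_word(1) by (simp add: words_iff_between[OF G] meet_right)
  have "((min_word F \<squnion>\<^bsub>weak_order n\<^esub> v) \<sqinter>\<^bsub>weak_order n\<^esub> max_word F, ?w) \<in> r"
    by (rule r_meet[OF r_join[OF eq(1) r_refl[OF vF(1)]] eq(2)])
  moreover have "min_word F \<squnion>\<^bsub>weak_order n\<^esub> v = v"
    using vF min_word by (intro join_eq)
  moreover have "v \<sqinter>\<^bsub>weak_order n\<^esub> max_word F = v"
    using vF max_word by (intro meet_eq)
  ultimately show "(v, ?w) \<in> r" by simp
qed

lemma op_equiv_iff_key_equiv:
  assumes F: "ordered_partition n F" and G: "ordered_partition n G"
  shows "op_equiv r F G \<longleftrightarrow> key_equiv (block_index F) (block_index G)"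
proof
  assume "key_equiv (block_index F) (block_index G)"
  then have FG: "(min_word F, min_word G) \<in> r" "(max_word F, max_word G) \<in> r"
    by (simp_all only: key_equiv_block_index)
  show "op_equiv r F G"
    unfolding op_equiv_def
    using key_equiv_imp_words[OF F G FG] key_equiv_imp_words[OF G F r_sym[OF FG(1)] r_sym[OF FG(2)]]
    by simp
qed (rule op_equiv_imp_key_equiv[OF F G])

end

section \<open>Swapping adjacent blocks\<close>

text \<open>No third block stands between adjacent blocks, so only the pair itself is
  reversed.\<close>

lemma precedes_swap:
  assumes "distinct (us @ [C, D] @ vs)"
  shows "precedes (us @ [D, C] @ vs) X Y \<longleftrightarrow>
    (precedes (us @ [C, D] @ vs) X Y \<and> (X, Y) \<noteq> (C, D)) \<or> (X, Y) = (D, C)"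
proof -
  have "\<not> precedes us C D" "\<not> precedes vs C D"
    using assms precedes_in_set[of us C D] precedes_in_set[of vs C D] by auto
  then show ?thesis
    using assms by (auto simp: precedes_append precedes_Cons not_precedes_Nil)
qed

lemma block_swap_precedes:
  assumes "block_swap P F F'"
  shows "\<exists>C D. P = {C, D} \<and> precedes F C D \<and> precedes F' D C"
proof -
  from assms obtain us C D vs where "F = us @ [C, D] @ vs" "F' = us @ [D, C] @ vs" "P = {C, D}"
    unfolding block_swap_def by blast
  then have "P = {C, D} \<and> precedes F C D \<and> precedes F' D C"
    by (simp add: precedes_append precedes_Cons)
  then show ?thesis by blast
qed

text \<open>If all adjacent pairs of \<open>xs\<close> were in the order of \<open>ys\<close>, then
  by transitivity all pairs would be, and the lists would be equal.\<close>

lemma ex_adjacent_descent: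
  assumes "distinct xs" "distinct ys" "set xs = set ys" "xs \<noteq> ys"
  obtains us C D vs where "xs = us @ [C, D] @ vs" "precedes ys D C"
proof -
  have "\<not> sorted_wrt (precedes ys) xs"
    using precedes_unique[OF assms(1-3)] assms(4) by (auto simp: sorted_wrt_iff_precedes)
  moreover have "transp (precedes ys)" using precedes_trans[OF assms(2)] by (rule transpI)
  ultimately obtain i where i: "Suc i < length xs" "\<not> precedes ys (xs ! i) (xs ! Suc i)"
    using sorted_wrt_iff_nth_Suc_transp by blast
  have "xs = take i xs @ xs ! i # xs ! Suc i # drop (Suc (Suc i)) xs"
    using i(1) by (simp add: Cons_nth_drop_Suc)
  moreover have "precedes ys (xs ! Suc i) (xs ! i)"
  proof -
    have "xs ! Suc i \<in> set ys" "xs ! i \<in> set ys" using i(1) assms(3) nth_mem by fastforce+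
    moreover have "xs ! Suc i \<noteq> xs ! i" using i(1) assms(1) by (simp add: nth_eq_iff_index_eq)
    ultimately show ?thesis using precedes_total i(2) by metis
  qed
  ultimately show thesis using that by simp
qed

lemma op_equiv_sym: "op_equiv r F G \<Longrightarrow> op_equiv r G F"
  by (simp add: op_equiv_def)

lemma precedes_block_index:
  assumes "ordered_partition n F" "precedes F D C" "x \<in> D" "y \<in> C"
  shows "block_index F x < block_index F y"
proof -
  obtain i j where ij: "i < j" "j < length F" "F ! i = D" "F ! j = C"
    using assms(2) unfolding precedes_def by blast
  then have "block_index F x = i" "block_index F y = j"
    using block_index_nth[OF ordered_partitionD(1,2)[OF assms(1)]] assms(3,4) by auto
  then show ?thesis using ij by simp
qed

context weak_order_congruence
begin

section \<open>Stable ordered partitions within an equivalence class\<close>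

lemma op_equiv_trans:
  assumes FG: "op_equiv r F G" and GH: "op_equiv r G H"
  shows "op_equiv r F H"
proof -
  have "\<exists>w\<in>words H'. (v, w) \<in> r"
    if "v \<in> words F'" "\<forall>v\<in>words F'. \<exists>w\<in>words G'. (v, w) \<in> r" "\<forall>v\<in>words G'. \<exists>w\<in>words H'. (v, w) \<in> r"
    for F' G' H' v
    using that r_trans by metis
  note step = this
  show ?thesis
    unfolding op_equiv_def
  proof (intro conjI ballI)
    show "\<exists>w\<in>words H. (v, w) \<in> r" if "v \<in> words F" for v
      by (rule step[OF that FG[unfolded op_equiv_def, THEN conjunct1]
            GH[unfolded op_equiv_def, THEN conjunct1]])
    show "\<exists>w\<in>words F. (v, w) \<in> r" if "v \<in> words H" for v
      by (rule step[OF that GH[unfolded op_equiv_def, THEN conjunct2]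
            FG[unfolded op_equiv_def, THEN conjunct2]])
  qed
qed

lemma op_equiv_refl:
  assumes "ordered_partition n F"
  shows "op_equiv r F F"
proof -
  have "(v, v) \<in> r" if "v \<in> words F" for v
    using that by (simp add: words_iff_between[OF assms] r_refl)
  then show ?thesis unfolding op_equiv_def by auto
qed

lemma stable_op_cong:
  assumes "stable_op n r F" "op_equiv r F G" "length G = length F"
  shows "stable_op n r G"
  unfolding stable_op_def
proof (intro allI impI)
  fix H assume "ordered_partition n H" "op_equiv r G H"
  then show "length H \<le> length G"
    using assms(1,3) op_equiv_trans[OF assms(2)] by (simp add: stable_op_def)
qed

text \<open>The common refinement of \<open>F\<close> and \<open>G\<close>, ordered lexicographically, lies between them and is
  hence equivalent to \<open>F\<close>; if \<open>F\<close> is stable, this refinement cannot be proper.\<close>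

lemma stable_op_block_index_eq:
  assumes F: "ordered_partition n F" and G: "ordered_partition n G"
    and eq: "op_equiv r F G" and st: "stable_op n r F"
    and xy: "x \<in> {1..n}" "y \<in> {1..n}" "block_index F x = block_index F y"
  shows "block_index G x = block_index G y"
proof -
  let ?k = "block_index F" and ?l = "block_index G"
  \<comment> \<open>\<open>N\<close> exceeds every index in \<open>G\<close>, so \<open>m\<close>
    encodes the pair of indices in lexicographic order, and \<open>div\<close> and
    \<open>mod\<close> recover its components.\<close>
  define N where "N = Suc (length G)"
  define m where "m x = ?k x * N + ?l x" for x
  have l: "?l x < N" if "x \<in> {1..n}" for x
    using block_index_less[of x G] ordered_partitionD(3)[OF G] that by (simp add: N_def)
  have div: "m x div N = ?k x" and mod: "m x mod N = ?l x" if "x \<in> {1..n}" for x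
    using l[OF that] by (simp_all add: m_def)
  obtain H where H: "ordered_partition n H" "length H = card (m ` {1..n})"
    "\<And>x y. x \<in> {1..n} \<Longrightarrow> y \<in> {1..n} \<Longrightarrow> block_index H x < block_index H y \<longleftrightarrow> m x < m y"
    by (rule ordered_partition_of_key[of n m]) (rule that)
  have "key_equiv ?k (block_index H)"
  proof (rule key_equiv_between)
    show "key_equiv ?k ?l" using op_equiv_iff_key_equiv[OF F G] eq by simp
    fix x y assume x: "x \<in> {1..n}" and y: "y \<in> {1..n}"
    {
      assume "?k x < ?k y" "?l x < ?l y"
      then have "m x < m y" unfolding m_def by (intro add_le_less_mono mult_le_mono1) simp_all
      then show "block_index H x < block_index H y" using H(3)[OF x y] by simp
    }
    {
      assume "block_index H x < block_index H y"
      then have less: "m x < m y" using H(3)[OF x y] by simp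
      show "?k x < ?k y \<or> ?l x < ?l y"
      proof (rule ccontr)
        assume "\<not> (?k x < ?k y \<or> ?l x < ?l y)"
        then have "m y \<le> m x" unfolding m_def by (intro add_le_mono mult_le_mono1) simp_all
        then show False using less by simp
      qed
    }
  qed
  then have "op_equiv r F H" using op_equiv_iff_key_equiv[OF F H(1)] by simp
  then have "length H \<le> length F" using st H(1) by (simp add: stable_op_def)
  \<comment> \<open>Division by \<open>N\<close> maps the keys, of which there are as many as blocks
    of \<open>H\<close>, onto the indices of \<open>F\<close>. Stability forces equal cardinalities,
    so the map is injective and elements sharing a block of \<open>F\<close> have equal
    keys.\<close>
  moreover have img: "(\<lambda>v. v div N) ` m ` {1..n} = {..<length F}"
    unfolding image_block_index[OF F, symmetric] image_image by (rule image_cong[OF HOL.refl div])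
  have "card (m ` {1..n}) \<ge> length F"
    using card_image_le[of "m ` {1..n}" "\<lambda>v. v div N"] unfolding img by simp
  ultimately have "card ((\<lambda>v. v div N) ` m ` {1..n}) = card (m ` {1..n})"
    unfolding img using H(2) by simp
  then have "inj_on (\<lambda>v. v div N) (m ` {1..n})"
    by (intro eq_card_imp_inj_on finite_imageI finite_atLeastAtMost)
  moreover have "m x div N = m y div N"
    using div[OF xy(1)] div[OF xy(2)] xy(3) by (simp only:)
  ultimately have "m x = m y"
    using imageI[OF xy(1), of m] imageI[OF xy(2), of m] by (rule inj_onD)
  then show ?thesis using mod[OF xy(1)] mod[OF xy(2)] by simp
qed

text \<open>By \<open>stable_op_block_index_eq\<close> in both directions, elements share a block of
  \<open>F\<close> exactly when they share one of \<open>G\<close>.\<close>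

lemma stable_op_set_eq:
  assumes F: "ordered_partition n F" "stable_op n r F" and G: "ordered_partition n G" "stable_op n r G"
    and eq: "op_equiv r F G"
  shows "set F = set G"
proof -
  have "{y \<in> {1..n}. block_index F y = block_index F x} = {y \<in> {1..n}. block_index G y = block_index G x}"
    if "x \<in> {1..n}" for x
    using stable_op_block_index_eq[OF F(1) G(1) eq F(2) _ that]
      stable_op_block_index_eq[OF G(1) F(1) op_equiv_sym[OF eq] G(2) _ that] by metis
  then show ?thesis
    unfolding set_ordered_partition[OF F(1)] set_ordered_partition[OF G(1)]
    by (rule image_cong[OF HOL.refl])
qed

text \<open>The swap alters the order only between elements of \<open>C\<close> and
  \<open>D\<close>, and there the new order agrees with \<open>G\<close>. The swapped partition
  therefore lies between the old one and \<open>G\<close>.\<close>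

lemma op_equiv_block_swap:
  assumes F: "ordered_partition n (us @ [C, D] @ vs)" and G: "ordered_partition n G"
    and eq: "op_equiv r (us @ [C, D] @ vs) G" and DC: "precedes G D C"
  shows "ordered_partition n (us @ [D, C] @ vs)" "op_equiv r (us @ [C, D] @ vs) (us @ [D, C] @ vs)"
proof -
  let ?F = "us @ [C, D] @ vs" and ?F' = "us @ [D, C] @ vs" and ?i = "length us"
  have "distinct ?F'" "set ?F' = set ?F" using ordered_partitionD(1)[OF F] by auto
  then show F': "ordered_partition n ?F'" using F by (simp add: ordered_partition_def)
  have CD: "C \<inter> D = {}" using ordered_partitionD(1,2)[OF F] by (auto simp: disjoint_def)
  \<comment> \<open>The index is composed with the transposition of two consecutive positions.
    Disjointness of \<open>C\<close> and \<open>D\<close> matters, as the index refers to the first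
    block containing \<open>x\<close>.\<close>
  have F'_index: "block_index ?F' x = (if block_index ?F x = ?i then Suc ?i
      else if block_index ?F x = Suc ?i then ?i else block_index ?F x)" for x
  proof (cases "x \<in> \<Union> (set us)")
    case True
    then show ?thesis using block_index_less[OF True] by (simp only: block_index_append if_True) simp
  next
    case False
    then show ?thesis using CD by (simp only: block_index_append if_False) auto
  qed
  have nth_F: "x \<in> ?F ! block_index ?F x" if "x \<in> {1..n}" for x
    using that unfolding ordered_partitionD(3)[OF F, symmetric] by (rule nth_block_index)
  have C: "x \<in> C" if "block_index ?F x = ?i" "x \<in> {1..n}" for x
    using nth_F[OF that(2)] that(1) by simp
  have D: "x \<in> D" if "block_index ?F x = Suc ?i" "x \<in> {1..n}" for x
    using nth_F[OF that(2)] that(1) by (simp add: nth_append)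
  have G_less: "block_index G x < block_index G y"
    if "block_index ?F x = Suc ?i" "block_index ?F y = ?i" "x \<in> {1..n}" "y \<in> {1..n}" for x y
    using precedes_block_index[OF G DC] C D that by blast
  have "key_equiv (block_index ?F) (block_index ?F')"
  proof (rule key_equiv_between)
    show "key_equiv (block_index ?F) (block_index G)" using op_equiv_iff_key_equiv[OF F G] eq by simp
    fix x y assume x: "x \<in> {1..n}" and y: "y \<in> {1..n}"
    {
      assume "block_index ?F x < block_index ?F y" "block_index G x < block_index G y"
      then show "block_index ?F' x < block_index ?F' y"
        using G_less[OF _ _ y x] unfolding F'_index by (auto split: if_splits)
    }
    {
      assume "block_index ?F' x < block_index ?F' y"
      then show "block_index ?F x < block_index ?F y \<or> block_index G x < block_index G y"
        using G_less[OF _ _ x y] unfolding F'_index by (auto split: if_splits)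
    }
  qed
  then show "op_equiv r ?F ?F'" using op_equiv_iff_key_equiv[OF F F'] by simp
qed

text \<open>Induction on the number of pairs of blocks that \<open>F\<close> and \<open>G\<close>
  order oppositely. The last clause strengthens the induction: since only such pairs are ever
  swapped, a pair that already agrees with \<open>G\<close> is not touched again.\<close>

lemma ex_swap_sequence:
  assumes "ordered_partition n F" "stable_op n r F" "op_equiv r F G"
    and G: "ordered_partition n G" "stable_op n r G"
  shows "\<exists>Fs. swap_sequence n r F G Fs \<and> swaps_at_most_once Fs \<and>
    (\<forall>P i. Suc i < length Fs \<longrightarrow> block_swap P (Fs ! i) (Fs ! Suc i) \<longrightarrow>
      (\<exists>C D. P = {C, D} \<and> precedes F C D \<and> precedes G D C))"
  using assms(1-3)
proof (induction "card {(C, D). precedes F C D \<and> precedes G D C}" arbitrary: F rule: less_induct)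
  case less
  note F = less.prems
  show ?case
  proof (cases "F = G")
    case True
    then have "swap_sequence n r F G [F]"
      using F op_equiv_refl by (simp add: swap_sequence_def)
    then show ?thesis by (intro exI[of _ "[F]"]) (simp add: swaps_at_most_once_def)
  next
    case False
    note dF = ordered_partitionD(1)[OF F(1)] and dG = ordered_partitionD(1)[OF G(1)]
    \<comment> \<open>Stability and equivalence give \<open>F\<close> and \<open>G\<close> the same
      blocks, so unless they are equal some adjacent pair of \<open>F\<close> is reversed in
      \<open>G\<close>.\<close>
    obtain us C D vs where F_eq: "F = us @ [C, D] @ vs" and DC: "precedes G D C"
      using ex_adjacent_descent[OF dF dG stable_op_set_eq[OF F(1,2) G F(3)] False] by metis
    define F' where "F' = us @ [D, C] @ vs"
    have F': "ordered_partition n F'" "op_equiv r F F'"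
      unfolding F'_def F_eq
      by (rule op_equiv_block_swap[OF F(1)[unfolded F_eq] G(1) F(3)[unfolded F_eq] DC])+
    have st: "stable_op n r F'"
      by (rule stable_op_cong[OF F(2) F'(2)]) (simp add: F_eq F'_def)
    have F'G: "op_equiv r F' G" using op_equiv_trans[OF op_equiv_sym[OF F'(2)] F(3)] .
    have swap: "precedes F' X Y \<longleftrightarrow> (precedes F X Y \<and> (X, Y) \<noteq> (C, D)) \<or> (X, Y) = (D, C)" for X Y
      unfolding F'_def F_eq by (rule precedes_swap[OF dF[unfolded F_eq]])
    have CD: "precedes F C D" by (simp add: F_eq precedes_append precedes_Cons)
    have nCD: "\<not> precedes G C D" by (rule precedes_asym[OF dG DC])
    \<comment> \<open>The swap removes \<open>(C, D)\<close> from this set of disagreements and adds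
      nothing, because \<open>(D, C)\<close> agrees with \<open>G\<close>.\<close>
    let ?I = "\<lambda>H. {(X, Y). precedes H X Y \<and> precedes G Y X}"
    have "?I F' \<subseteq> ?I F" using nCD by (auto simp: swap)
    moreover have "(C, D) \<in> ?I F" using CD DC by simp
    moreover have "(C, D) \<notin> ?I F'" using DC nCD by (auto simp: swap)
    ultimately have "?I F' \<subset> ?I F" by blast
    moreover have "finite (?I F)"
    proof (rule finite_subset)
      show "?I F \<subseteq> set F \<times> set F" using precedes_in_set[of F] by auto
    qed simp
    ultimately have "card (?I F') < card (?I F)" by (intro psubset_card_mono)
    from less.hyps[OF this F'(1) st F'G] obtain Fs where
      "swap_sequence n r F' G Fs \<and> swaps_at_most_once Fs \<and>
      (\<forall>P i. Suc i < length Fs \<longrightarrow> block_swap P (Fs ! i) (Fs ! Suc i) \<longrightarrow>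
        (\<exists>X Y. P = {X, Y} \<and> precedes F' X Y \<and> precedes G Y X))"
      by (rule exE)
    then have Fs: "swap_sequence n r F' G Fs" and once: "swaps_at_most_once Fs"
      and pairs: "Suc i < length Fs \<Longrightarrow> block_swap P (Fs ! i) (Fs ! Suc i) \<Longrightarrow>
        \<exists>X Y. P = {X, Y} \<and> precedes F' X Y \<and> precedes G Y X" for P i
      by simp_all
    have Fs0: "Fs \<noteq> []" "Fs ! 0 = F'" using Fs by (auto simp: swap_sequence_def hd_conv_nth)
    \<comment> \<open>Only one pair of blocks changes its order from \<open>F\<close> to
      \<open>F'\<close>, so the label of this swap is unique.\<close>
    have first: "P = {C, D}" if P: "block_swap P F F'" for P
    proof -
      obtain X Y where XY: "P = {X, Y}" "precedes F X Y" "precedes F' Y X"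
        using block_swap_precedes[OF P] by metis
      then have "(Y, X) = (D, C)" using swap[of Y X] precedes_asym[OF dF XY(2)] by metis
      then show ?thesis using XY(1) by auto
    qed
    \<comment> \<open>In \<open>F'\<close> the blocks \<open>C\<close> and \<open>D\<close> stand as
      in \<open>G\<close>, hence by the strengthened hypothesis they are not swapped in
      \<open>Fs\<close>.\<close>
    have later: "P \<noteq> {C, D}"
      if P: "Suc i < length Fs" "block_swap P (Fs ! i) (Fs ! Suc i)" for P i
    proof
      assume "P = {C, D}"
      obtain X Y where XY: "P = {X, Y}" "precedes F' X Y" "precedes G Y X"
        using pairs[OF P] by metis
      then have "X = C \<and> Y = D \<or> X = D \<and> Y = C"
        using \<open>P = {C, D}\<close> by (metis doubleton_eq_iff)
      moreover have "\<not> precedes F' C D" using nCD DC swap[of C D] by auto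
      ultimately show False using XY(2,3) nCD by metis
    qed
    show ?thesis
    proof (intro exI[of _ "F # Fs"] conjI allI impI)
      have "\<exists>P. block_swap P ((F # Fs) ! i) ((F # Fs) ! Suc i)" if "Suc i < length (F # Fs)" for i
      proof (cases i)
        case 0
        have "block_swap {C, D} F F'" unfolding block_swap_def F_eq F'_def
          by (rule exI[of _ us], rule exI[of _ C], rule exI[of _ D], rule exI[of _ vs]) simp
        then show ?thesis unfolding 0 nth_Cons_0 nth_Cons_Suc Fs0(2) by (rule exI)
      next
        case (Suc j)
        then show ?thesis using Fs that by (simp add: swap_sequence_def)
      qed
      moreover have "ordered_partition n X \<and> stable_op n r X \<and> op_equiv r X F \<and> op_equiv r X G"
        if "X \<in> set (F # Fs)" for X
      proof (cases "X = F")
        case True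
        then show ?thesis using F op_equiv_refl by simp
      next
        case False
        then have "ordered_partition n X \<and> stable_op n r X \<and> op_equiv r X F' \<and> op_equiv r X G"
          using that Fs by (simp add: swap_sequence_def)
        then show ?thesis using op_equiv_trans[OF _ op_equiv_sym[OF F'(2)], of X] by metis
      qed
      moreover have "last (F # Fs) = G" using Fs Fs0(1) by (simp add: swap_sequence_def)
      ultimately show "swap_sequence n r F G (F # Fs)"
        unfolding swap_sequence_def by (intro conjI allI impI ballI) simp_all
      show "swaps_at_most_once (F # Fs)"
        unfolding swaps_at_most_once_def
      proof (intro allI impI)
        fix P i j
        assume len: "Suc i < length (F # Fs)" "Suc j < length (F # Fs)"
          and sw: "block_swap P ((F # Fs) ! i) ((F # Fs) ! Suc i)"
            "block_swap P ((F # Fs) ! j) ((F # Fs) ! Suc j)"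
        \<comment> \<open>The pair \<open>{C, D}\<close> marks exactly the first swap, so two swaps
          of one pair are either both first or both inside \<open>Fs\<close>.\<close>
        have zero_iff: "k = 0 \<longleftrightarrow> P = {C, D}"
          if k: "Suc k < length (F # Fs)" "block_swap P ((F # Fs) ! k) ((F # Fs) ! Suc k)" for k
        proof (cases k)
          case 0
          then show ?thesis using k(2) Fs0(2) first[of P] by simp
        next
          case (Suc k')
          then show ?thesis using k later[of k' P] by simp
        qed
        show "i = j"
        proof (cases i)
          case 0
          then show ?thesis using zero_iff[OF len(1) sw(1)] zero_iff[OF len(2) sw(2)] by simp
        next
          case (Suc i')
          then obtain j' where j': "j = Suc j'"
            using zero_iff[OF len(1) sw(1)] zero_iff[OF len(2) sw(2)] by (cases j) simp_all
          have "Suc i' < length Fs" "Suc j' < length Fs"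
            "block_swap P (Fs ! i') (Fs ! Suc i')" "block_swap P (Fs ! j') (Fs ! Suc j')"
            using len sw by (simp_all add: Suc j')
          then have "i' = j'" using once unfolding swaps_at_most_once_def by metis
          then show ?thesis using Suc j' by simp
        qed
      qed
      fix P i
      assume len: "Suc i < length (F # Fs)" and sw: "block_swap P ((F # Fs) ! i) ((F # Fs) ! Suc i)"
      show "\<exists>X Y. P = {X, Y} \<and> precedes F X Y \<and> precedes G Y X"
      proof (cases i)
        case 0
        then have "P = {C, D}" using sw Fs0 first by simp
        then show ?thesis using CD DC by blast
      next
        case (Suc j)
        then obtain X Y where XY: "P = {X, Y}" "precedes F' X Y" "precedes G Y X"
          using pairs[of j P] len sw by (simp only: length_Cons Suc_less_eq nth_Cons_Suc) metis
        \<comment> \<open>The only order relation new in \<open>F'\<close> is \<open>D\<close>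
          before \<open>C\<close>, which is excluded because \<open>G\<close> does not put
          \<open>C\<close> before \<open>D\<close>.\<close>
        then have "precedes F X Y" using swap[of X Y] nCD by auto
        then show ?thesis using XY by metis
      qed
    qed
  qed
qed

end

theorem theorem26:
  fixes n d :: nat and r :: "(nat list \<times> nat list) set" and F\<^sub>A F\<^sub>B :: "nat set list"
  assumes "lattice_congruence (weak_order n) r"
    and "d \<le> n"
    and "ordered_partition n F\<^sub>A" and "length F\<^sub>A = n - d" and "stable_op n r F\<^sub>A"
    and "ordered_partition n F\<^sub>B" and "length F\<^sub>B = n - d" and "stable_op n r F\<^sub>B"
    and "op_equiv r F\<^sub>A F\<^sub>B"
  shows "(\<exists>Fs. swap_sequence n r F\<^sub>A F\<^sub>B Fs) \<and>
    mset F\<^sub>B = mset F\<^sub>A \<and>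
    (\<exists>Fs. swap_sequence n r F\<^sub>A F\<^sub>B Fs \<and> swaps_at_most_once Fs)"
proof -
  interpret weak_order_congruence n r by (rule weak_order_congruence.intro[OF assms(1)])
  have "set F\<^sub>B = set F\<^sub>A" using stable_op_set_eq[OF assms(3,5,6,8,9)] by (rule HOL.sym)
  \<comment> \<open>Both lists of blocks are distinct, so equality of their sets already makes one a
    reordering of the other.\<close>
  then have "mset F\<^sub>B = mset F\<^sub>A"
    using set_eq_iff_mset_eq_distinct[OF ordered_partitionD(1)[OF assms(6)] ordered_partitionD(1)[OF assms(3)]]
    by (rule iffD1[rotated])
  moreover obtain Fs where "swap_sequence n r F\<^sub>A F\<^sub>B Fs" "swaps_at_most_once Fs"
    using ex_swap_sequence[OF assms(3,5,9,6,8)] by (elim exE conjE)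
  ultimately show ?thesis by (intro conjI exI)
qed

end
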